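(* Let $(X,T)$ be a dynamical system. A closed subset $E$ of $X$ is $\Delta$-weakly mixing if and only if there exists an increasing sequence $C_1\subset C_2\subset\cdots$ of Cantor sets contained in $E$ such that $C=\bigcup_{k=1}^\infty C_k$ is dense in $E$ and the following two conditions hold: (1) for any $d\in\mathbb{N}$, any subset $A$ of $C$, and any continuous functions $g_j\colon A\to E$, $j=1,2,\dots,d$, there exists an increasing sequence $\{q_i\}_{i=1}^\infty$ of positive integers such that $$\lim_{i\to\infty}T^{j\cdot q_i}x=g_j(x)$$ for every $x\in A$ and $j=1,2,\dots,d$; (2) for any $d\in\mathbb{N}$, $k\in\mathbb{N}$, any closed subset $B$ of $C_k$, and any continuous functions $h_j\colon B\to E$, $j=1,2,\dots,d$, there exists an increasing sequence $\{q_i\}_{i=1}^\infty$ of positive integers such that $$\lim_{i\to\infty}T^{j\cdot q_i}x=h_j(x)$$ uniformly in $x\in B$ and $j=1,2,\dots,d$.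
   Context: A dynamical system $(X,T)$ is a compact metric space $(X,\rho)$ with a continuous map $T\colon X\to X$. $\mathbb{N}$ is the set of positive integers. A Cantor set is a non-empty compact, perfect (no isolated points), totally disconnected set. A set $U$ intersects $A$ if $U\cap A\neq\emptyset$. For subsets $S_1,\dots,S_d$ of $X$ ($d\ge2$), $N(S_1,\dots,S_d)=\{n\in\mathbb{N}\colon \bigcap_{i=1}^d T^{-(i-1)n}S_i\neq\emptyset\}$. A closed subset $A$ of $X$ with at least two points is $\Delta$-weakly mixing if for every $n\ge1$, $d\ge2$ and all non-empty open subsets $U_{i,j}$ of $X$ intersecting $A$ ($1\le i\le n$, $1\le j\le d$), $$\bigcap_{i=1}^n N(U_{i,1}\cap A,U_{i,2},\dots,U_{i,d})\neq\emptyset.$$ *)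

theory Defs
  imports "HOL-Analysis.Analysis"
begin

text \<open>The phase space is a compact subset \<open>X\<close> of a metric space type, with the induced metric;
  \<open>T\<close> is irrelevant outside \<open>X\<close>. Topological notions in \<open>X\<close> are those of \<open>top_of_set X\<close>.\<close>

definition dynamical_system :: "'a::metric_space set \<Rightarrow> ('a \<Rightarrow> 'a) \<Rightarrow> bool" where
  "dynamical_system X T \<longleftrightarrow> compact X \<and> continuous_on X T \<and> T \<in> X \<rightarrow> X"

definition totally_disconnected :: "'a::topological_space set \<Rightarrow> bool" where
  "totally_disconnected S \<longleftrightarrow> (\<forall>x\<in>S. connected_component_set S x = {x})"

definition cantor_set :: "'a::metric_space set \<Rightarrow> bool" where
  "cantor_set S \<longleftrightarrow>
     S \<noteq> {} \<and> compact S \<and> (\<forall>x\<in>S. x islimpt S) \<and> totally_disconnected S"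

text \<open>The tuple \<open>S\<^sub>1, \<dots>, S\<^sub>d\<close> is encoded by a function of which only the values
  at \<open>1, \<dots>, d\<close> matter.\<close>

definition return_times ::
    "'a set \<Rightarrow> ('a \<Rightarrow> 'a) \<Rightarrow> nat \<Rightarrow> (nat \<Rightarrow> 'a set) \<Rightarrow> nat set" where
  "return_times X T d S =
     {n. 1 \<le> n \<and> (\<Inter>i\<in>{1..d}. {x \<in> X. (T ^^ ((i - 1) * n)) x \<in> S i}) \<noteq> {}}"

definition delta_weakly_mixing ::
    "'a::metric_space set \<Rightarrow> ('a \<Rightarrow> 'a) \<Rightarrow> 'a set \<Rightarrow> bool" where
  "delta_weakly_mixing X T A \<longleftrightarrow>
     closedin (top_of_set X) A \<and> (\<exists>x\<in>A. \<exists>y\<in>A. x \<noteq> y) \<and>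
     (\<forall>n d. \<forall>U :: nat \<Rightarrow> nat \<Rightarrow> 'a set.
        1 \<le> n \<longrightarrow> 2 \<le> d \<longrightarrow>
        (\<forall>i\<in>{1..n}. \<forall>j\<in>{1..d}. openin (top_of_set X) (U i j) \<and> U i j \<inter> A \<noteq> {}) \<longrightarrow>
        (\<Inter>i\<in>{1..n}. return_times X T d (\<lambda>j. if j = 1 then U i 1 \<inter> A else U i j)) \<noteq> {})"

end

theory Submission
  imports Defs
begin

text \<open>For the hard direction, build a Cantor scheme inside \<open>E\<close>: at stage \<open>m\<close> finitely many disjoint small balls,
  nearly dense in \<open>E\<close>, each containing two balls of stage \<open>m + 1\<close>. Weak mixing and continuity let
  us shrink the balls so that each assignment of targets (from a finite net of \<open>E\<close>) to pairs
  (ball, \<open>j\<close>) with \<open>1 \<le> j \<le> m + 1\<close> is approximated by \<open>T\<^sup>j\<^sup>q\<close> on all balls for one common \<open>q \<ge> m\<close>. The set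
  \<open>C\<^sub>k\<close> consists of the points that remain in descendants of the stage-\<open>k\<close> balls. Given \<open>g\<close> on \<open>A\<close>,
  use the value of \<open>g\<close> at one point of \<open>A\<close> in each ball as target; as the balls shrink, continuity gives
  pointwise convergence, and uniform continuity gives uniform convergence. Conversely, mixing needs
  condition (1) only for finite sets \<open>A\<close>, with distinct points because Cantor sets are perfect.\<close>

section \<open>Cantor schemes of balls\<close>

text \<open>\<open>F m\<close> holds the centres of the stage-\<open>m\<close> balls, all of radius
  \<open>r m\<close>. A ball of stage \<open>m + 1\<close> may lie outside all balls of stage
  \<open>m\<close>; such new balls keep the centres spread over \<open>E\<close>, and they are why
  an increasing sequence of Cantor sets arises instead of a single one.\<close>

locale cantor_scheme =
  fixes E :: "'a::metric_space set" and F :: "nat \<Rightarrow> 'a set" and r :: "nat \<Rightarrow> real"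
  assumes compact_E: "compact E"
    and finite_F: "finite (F m)"
    and F_subset: "F m \<subseteq> E"
    and F_nonempty: "F m \<noteq> {}"
    and r_pos: "0 < r m"
    and r_small: "r m < inverse (Suc m)"
    and disjoint_balls: "\<lbrakk>x \<in> F m; y \<in> F m; x \<noteq> y\<rbrakk> \<Longrightarrow> cball x (r m) \<inter> cball y (r m) = {}"
    and children: "x \<in> F m \<Longrightarrow>
      \<exists>y\<in>F (Suc m). \<exists>z\<in>F (Suc m). y \<noteq> z \<and>
        cball y (r (Suc m)) \<subseteq> cball x (r m) \<and> cball z (r (Suc m)) \<subseteq> cball x (r m)"
    and dense_F: "z \<in> E \<Longrightarrow> \<exists>x\<in>F m. dist z x < 2 * inverse (Suc m)"
begin

section \<open>Chains of nested balls and their limit sets\<close>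

fun descendants :: "nat \<Rightarrow> nat \<Rightarrow> 'a set" where
  "descendants k 0 = F k"
| "descendants k (Suc n) =
    {y \<in> F (k + Suc n). \<exists>x\<in>descendants k n. cball y (r (k + Suc n)) \<subseteq> cball x (r (k + n))}"

text \<open>Cutting with the compact set \<open>E\<close> makes the layers compact; closed balls of
  a metric space alone need not be.\<close>

definition layer :: "nat \<Rightarrow> nat \<Rightarrow> 'a set" where
  "layer k n = (\<Union>x\<in>descendants k n. cball x (r (k + n)) \<inter> E)"

definition limit_set :: "nat \<Rightarrow> 'a set" where
  "limit_set k = (\<Inter>n. layer k n)"

lemma descendants_subset: "descendants k n \<subseteq> F (k + n)"
  by (cases n) auto

lemma finite_descendants: "finite (descendants k n)"
  using finite_subset[OF descendants_subset finite_F] .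

lemma compact_layer: "compact (layer k n)"
  unfolding layer_def
  by (intro compact_UN finite_descendants closed_Int_compact compact_E closed_cball)

lemma layer_Suc: "layer k (Suc n) \<subseteq> layer k n"
  unfolding layer_def by fastforce

lemma layer_antimono: "n \<le> n' \<Longrightarrow> layer k n' \<subseteq> layer k n"
  by (rule lift_Suc_antimono_le[of "layer k"]) (auto simp: layer_Suc)

lemma compact_limit_set: "compact (limit_set k)"
proof -
  have "closed (limit_set k)"
    unfolding limit_set_def by (intro closed_INT ballI compact_imp_closed compact_layer)
  moreover have "limit_set k \<subseteq> layer k 0"
    unfolding limit_set_def by blast
  ultimately show ?thesis
    using compact_layer closed_Int_compact[of "limit_set k" "layer k 0"] by (simp add: inf.absorb1)
qed

lemma limit_set_subset: "limit_set k \<subseteq> E"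
  unfolding limit_set_def layer_def by blast

text \<open>A chain of nested balls starting at stage \<open>k\<close> becomes, without its first
  ball, a chain starting at stage \<open>k + 1\<close>, because every ball of stage
  \<open>k + 1\<close> is allowed as a start.\<close>

lemma descendants_Suc_subset: "descendants k (Suc n) \<subseteq> descendants (Suc k) n"
proof (induction n)
  case (Suc n)
  show ?case
  proof
    fix y assume "y \<in> descendants k (Suc (Suc n))"
    then obtain x where "y \<in> F (Suc k + Suc n)" "x \<in> descendants k (Suc n)"
      "cball y (r (Suc k + Suc n)) \<subseteq> cball x (r (Suc k + n))"
      by (auto simp del: descendants.simps(2) simp: descendants.simps(2)[of k "Suc n"])
    with Suc show "y \<in> descendants (Suc k) (Suc n)"
      by auto
  qed
qed auto

lemma limit_set_Suc: "limit_set k \<subseteq> limit_set (Suc k)"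
proof -
  have "layer k (Suc n) \<subseteq> layer (Suc k) n" for n
    using descendants_Suc_subset[of k n] unfolding layer_def
    by (auto simp del: descendants.simps(2))
  then show ?thesis
    unfolding limit_set_def by blast
qed

text \<open>Follow one child at each stage. This supplies points of arbitrarily deep layers inside a
  given ball.\<close>

lemma descendant_below:
  assumes "x \<in> descendants k n"
  shows "\<exists>y\<in>descendants k (n + i). cball y (r (k + (n + i))) \<subseteq> cball x (r (k + n))"
proof (induction i)
  case (Suc i)
  then obtain y where y: "y \<in> descendants k (n + i)"
    "cball y (r (k + (n + i))) \<subseteq> cball x (r (k + n))" by blast
  then have "y \<in> F (k + (n + i))" using descendants_subset by blast
  then obtain z where "z \<in> F (Suc (k + (n + i)))"
    "cball z (r (Suc (k + (n + i)))) \<subseteq> cball y (r (k + (n + i)))"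
    using children by blast
  with y show ?case by (intro bexI[of _ z]) auto
qed (use assms in auto)

text \<open>The layers are compact and decreasing, so by the finite intersection property it
  suffices that each of them meets the ball; the centre of a deep enough descendant shows
  this.\<close>

lemma limit_set_meets_ball:
  assumes "x \<in> descendants k n"
  shows "limit_set k \<inter> cball x (r (k + n)) \<noteq> {}"
proof -
  have "layer k 0 \<inter> (\<Inter>i\<in>UNIV. layer k i \<inter> cball x (r (k + n))) \<noteq> {}"
  proof (rule compact_imp_fip_image)
    show "compact (layer k 0)" by (rule compact_layer)
    show "closed (layer k i \<inter> cball x (r (k + n)))" for i
      by (intro closed_Int compact_imp_closed compact_layer closed_cball)
  next
    fix I :: "nat set" assume I: "finite I" "I \<subseteq> UNIV"
    obtain N where N: "I \<subseteq> {..N}" using finite_nat_iff_bounded_le I by blast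
    obtain y where y: "y \<in> descendants k (n + N)" "cball y (r (k + (n + N))) \<subseteq> cball x (r (k + n))"
      using descendant_below[OF assms] by blast
    moreover have "y \<in> E" using y(1) descendants_subset F_subset by blast
    moreover have "y \<in> cball y (r (k + (n + N)))" using r_pos[of "k + (n + N)"] by auto
    ultimately have 1: "y \<in> layer k (n + N)" "y \<in> cball x (r (k + n))"
      unfolding layer_def by blast+
    have "y \<in> layer k i" if "i \<le> N" for i
      using layer_antimono[of i "n + N" k] 1 that by auto
    with 1 N show "layer k 0 \<inter> (\<Inter>i\<in>I. layer k i \<inter> cball x (r (k + n))) \<noteq> {}"
      by blast
  qed
  then show ?thesis unfolding limit_set_def by blast
qed

text \<open>From stage \<open>k\<close> on, the balls of each stage cover
  \<open>limit_set k\<close>; bounds valid on every ball of a stage therefore apply to all its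
  points.\<close>

lemma limit_set_in_ball:
  assumes "z \<in> limit_set k" "k \<le> m"
  obtains x where "x \<in> F m" "z \<in> cball x (r m)"
proof -
  have "z \<in> layer k (m - k)" using assms unfolding limit_set_def by auto
  then show ?thesis
    using that descendants_subset[of k "m - k"] assms(2) unfolding layer_def by auto
qed

section \<open>Perfectness, total disconnectedness and density of the limit sets\<close>

lemma r_eventually_small:
  assumes "0 < e"
  obtains N where "\<And>m. N \<le> m \<Longrightarrow> r m < e"
proof -
  obtain N where N: "inverse (real (Suc N)) < e" using reals_Archimedean[OF assms] by blast
  have "r m < e" if "N \<le> m" for m
  proof -
    have "inverse (real (Suc m)) \<le> inverse (real (Suc N))" using that by (intro le_imp_inverse_le) auto
    with N r_small[of m] show ?thesis by linarith
  qed
  with that show ?thesis by blast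
qed

text \<open>A small ball of the chain around \<open>z\<close> has two disjoint child balls, each
  meeting the limit set; at least one of the two points found there differs from
  \<open>z\<close>.\<close>

lemma islimpt_limit_set:
  assumes z: "z \<in> limit_set k"
  shows "z islimpt limit_set k"
  unfolding islimpt_approachable
proof (intro allI impI)
  fix e :: real assume "0 < e"
  then obtain N where N: "\<And>m. N \<le> m \<Longrightarrow> r m < e / 2" using r_eventually_small[of "e / 2"] by auto
  from z have "z \<in> layer k N" unfolding limit_set_def by blast
  then obtain x where x: "x \<in> descendants k N" "z \<in> cball x (r (k + N))"
    unfolding layer_def by blast
  then have "x \<in> F (k + N)" using descendants_subset by blast
  then obtain y y' where y: "y \<in> F (Suc (k + N))" "y' \<in> F (Suc (k + N))" "y \<noteq> y'"
    "cball y (r (Suc (k + N))) \<subseteq> cball x (r (k + N))"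
    "cball y' (r (Suc (k + N))) \<subseteq> cball x (r (k + N))"
    using children by metis
  have "y \<in> descendants k (Suc N)" "y' \<in> descendants k (Suc N)" using x y by auto
  then obtain w w' where w: "w \<in> limit_set k" "w \<in> cball y (r (Suc (k + N)))"
    "w' \<in> limit_set k" "w' \<in> cball y' (r (Suc (k + N)))"
    using limit_set_meets_ball by (metis add_Suc_right disjoint_iff)
  have "w \<noteq> w'" using disjoint_balls[OF y(1-3)] w by blast
  have close: "dist u z < e" if "u \<in> cball x (r (k + N))" for u
    using that x(2) N[of "k + N"] dist_triangle3[of u z x] by auto
  show "\<exists>x'\<in>limit_set k. x' \<noteq> z \<and> dist x' z < e"
    using w \<open>w \<noteq> w'\<close> close y by (metis subsetD)
qed

text \<open>At each late stage, finitely many disjoint closed balls cover the limit set, so a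
  connected subset stays in one of them; the radii tend to 0.\<close>

lemma totally_disconnected_limit_set: "totally_disconnected (limit_set k)"
  unfolding totally_disconnected_def
proof (intro ballI equalityI subsetI)
  fix z w assume z: "z \<in> limit_set k" and "w \<in> connected_component_set (limit_set k) z"
  then obtain S where S: "connected S" "S \<subseteq> limit_set k" "z \<in> S" "w \<in> S"
    unfolding connected_component_def by auto
  have "dist z w \<le> 0"
  proof (rule field_le_epsilon)
    fix e :: real assume "0 < e"
    then obtain N where N: "\<And>m. N \<le> m \<Longrightarrow> r m < e / 2" using r_eventually_small[of "e / 2"] by auto
    \<comment> \<open>The covering by stage-\<open>m\<close> balls is available only for
      \<open>m\<close> at least \<open>k\<close>.\<close>
    define m where "m = max k N"
    obtain x where x: "x \<in> F m" "z \<in> cball x (r m)"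
      using limit_set_in_ball[OF z, of m] unfolding m_def by auto
    let ?R = "\<Union>y\<in>F m - {x}. cball y (r m)"
    have "closed ?R" using finite_F by auto
    moreover have "cball x (r m) \<inter> ?R = {}" using disjoint_balls x(1) by blast
    moreover have "S \<subseteq> cball x (r m) \<union> ?R"
    proof
      fix u assume "u \<in> S"
      with S have "u \<in> limit_set k" by blast
      then obtain y where "y \<in> F m" "u \<in> cball y (r m)"
        by (rule limit_set_in_ball[of _ _ m]) (auto simp: m_def)
      then show "u \<in> cball x (r m) \<union> ?R" by blast
    qed
    ultimately have "cball x (r m) \<inter> S = {} \<or> ?R \<inter> S = {}"
      using connected_closedD[OF S(1), of "cball x (r m)" ?R] by auto
    with x S have "?R \<inter> S = {}" by blast
    with \<open>S \<subseteq> cball x (r m) \<union> ?R\<close> S have "w \<in> cball x (r m)" by blast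
    with x(2) N[of m] dist_triangle3[of z w x] show "dist z w \<le> 0 + e"
      unfolding m_def by auto
  qed
  then show "w \<in> {z}" by simp
qed (auto simp: connected_component_refl)

lemma cantor_set_limit_set: "cantor_set (limit_set k)"
proof -
  obtain x where "x \<in> descendants k 0" using F_nonempty by auto
  then have "limit_set k \<noteq> {}" using limit_set_meets_ball by blast
  then show ?thesis
    by (simp add: cantor_set_def compact_limit_set islimpt_limit_set totally_disconnected_limit_set)
qed

lemma limit_sets_dense: "E \<subseteq> closure (\<Union>k. limit_set k)"
proof
  fix z assume z: "z \<in> E"
  show "z \<in> closure (\<Union>k. limit_set k)"
    unfolding closure_approachable
  proof (intro allI impI)
    fix e :: real assume "0 < e"
    then obtain N where N: "inverse (real (Suc N)) < e / 3"
      using reals_Archimedean[of "e / 3"] by auto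
    obtain x where x: "x \<in> F N" "dist z x < 2 * inverse (Suc N)" using dense_F z by blast
    \<comment> \<open>Every centre of stage \<open>N\<close> starts a chain, being in
      \<open>descendants N 0\<close>, so its ball meets \<open>limit_set N\<close>.\<close>
    then obtain w where w: "w \<in> limit_set N" "w \<in> cball x (r N)"
      using limit_set_meets_ball[of x N 0] by auto
    have "dist w z < e"
      using w(2) x(2) N r_small[of N] dist_triangle2[of w z x] by (auto simp: dist_commute)
    with w show "\<exists>y\<in>\<Union>k. limit_set k. dist y z < e" by blast
  qed
qed

end

section \<open>Simultaneous approximation along a scheme\<close>

lemma strict_mono_subsequence:
  fixes q :: "nat \<Rightarrow> nat"
  assumes "\<And>m. m \<le> q m"
  obtains s :: "nat \<Rightarrow> nat" where "strict_mono s" "strict_mono (q \<circ> s)" "\<And>i. 0 < q (s i)"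
proof -
  \<comment> \<open>Each index exceeds the preceding value of \<open>q\<close>, which forces
    \<open>q\<close> to increase along \<open>s\<close>; starting at 1 instead of 0 makes
    \<open>q (s 0)\<close> positive.\<close>
  define s where "s = rec_nat 1 (\<lambda>_ n. Suc (q n))"
  have [simp]: "s 0 = 1" "\<And>i. s (Suc i) = Suc (q (s i))" by (simp_all add: s_def)
  have "s i < s (Suc i)" for i using assms[of "s i"] by simp
  moreover have "(q \<circ> s) i < (q \<circ> s) (Suc i)" for i using assms[of "s (Suc i)"] by simp
  moreover have "0 < q (s i)" for i
    using assms[of "s i"] by (cases i) auto
  ultimately show ?thesis by (intro that[of s]) (simp_all add: strict_mono_Suc_iff)
qed

text \<open>One \<open>q\<close> must serve all balls and all exponents for a given assignment
  \<open>t\<close> of targets. The range of exponents grows with \<open>m\<close>, so that every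
  \<open>d\<close> is covered from some stage on, and \<open>q\<close> is at least \<open>m\<close>
  so that increasing sequences can be extracted.\<close>

definition steered ::
    "('a::metric_space \<Rightarrow> 'a) \<Rightarrow> 'a set \<Rightarrow> nat \<Rightarrow> 'a set \<Rightarrow> real \<Rightarrow> bool" where
  "steered T E m F r \<longleftrightarrow>
    (\<forall>t. (\<forall>x\<in>F. \<forall>j\<in>{1..Suc m}. t x j \<in> E) \<longrightarrow>
      (\<exists>q\<ge>m. \<forall>x\<in>F. \<forall>j\<in>{1..Suc m}. \<forall>y\<in>cball x r \<inter> E.
        dist ((T ^^ (j * q)) y) (t x j) < inverse (real (Suc m))))"

lemma steeredD:
  assumes "steered T E m F r" "\<And>x j. \<lbrakk>x \<in> F; j \<in> {1..Suc m}\<rbrakk> \<Longrightarrow> t x j \<in> E"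
  shows "\<exists>q\<ge>m. \<forall>x\<in>F. \<forall>j\<in>{1..Suc m}. \<forall>y\<in>cball x r \<inter> E.
    dist ((T ^^ (j * q)) y) (t x j) < inverse (real (Suc m))"
  using assms unfolding steered_def by blast

locale steered_scheme = cantor_scheme E F r
  for E :: "'a::metric_space set" and F r +
  fixes T :: "'a \<Rightarrow> 'a"
  assumes steered: "steered T E m (F m) (r m)"
begin

text \<open>Each ball that meets \<open>A\<close> gets a representative in \<open>A\<close>, and the
  values of \<open>g\<close> there serve as targets. For \<open>z\<close> in the ball,
  \<open>a z\<close> is this representative; both lie in one ball of radius below 1/(m+1), hence the
  factor 2.\<close>

lemma approximation_stage:
  assumes "\<And>j. j \<in> {1..d} \<Longrightarrow> g j \<in> A \<rightarrow> E" "d \<le> m"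
  shows "\<exists>q\<ge>m. \<exists>a. \<forall>k\<le>m. \<forall>z\<in>A \<inter> limit_set k. a z \<in> A \<and> dist (a z) z < 2 * inverse (real (Suc m)) \<and>
    (\<forall>j\<in>{1..d}. dist ((T ^^ (j * q)) z) (g j (a z)) < inverse (real (Suc m)))"
proof -
  \<comment> \<open>\<open>e0\<close> is a dummy target for balls that miss \<open>A\<close> and for
    exponents above \<open>d\<close>.\<close>
  obtain e0 where e0: "e0 \<in> E" using F_nonempty F_subset by blast
  define c where "c x = (SOME u. u \<in> A \<inter> cball x (r m))" for x
  have c: "c x \<in> A \<inter> cball x (r m)" if "u \<in> A \<inter> cball x (r m)" for x u
    unfolding c_def using that by (rule someI)
  define t where "t x j = (if j \<le> d \<and> c x \<in> A then g j (c x) else e0)" for x j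
  have t_in: "t x j \<in> E" if "j \<in> {1..Suc m}" for x j
    using assms(1)[of j] e0 that unfolding t_def by auto
  obtain q where q: "q \<ge> m" "\<And>x j y. \<lbrakk>x \<in> F m; j \<in> {1..Suc m}; y \<in> cball x (r m) \<inter> E\<rbrakk> \<Longrightarrow>
      dist ((T ^^ (j * q)) y) (t x j) < inverse (real (Suc m))"
    using steeredD[OF steered[of m], of t] t_in by blast
  \<comment> \<open>A choice of ball for each \<open>z\<close> that does not depend on
    \<open>k\<close>, so that one map \<open>a\<close> serves all limit sets up to stage
    \<open>m\<close>.\<close>
  define b where "b z = (SOME x. x \<in> F m \<and> z \<in> cball x (r m))" for z
  have "c (b z) \<in> A \<and> dist (c (b z)) z < 2 * inverse (real (Suc m)) \<and>
    (\<forall>j\<in>{1..d}. dist ((T ^^ (j * q)) z) (g j (c (b z))) < inverse (real (Suc m)))"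
    if k: "k \<le> m" "z \<in> A \<inter> limit_set k" for z k
  proof -
    have "\<exists>x. x \<in> F m \<and> z \<in> cball x (r m)"
      using limit_set_in_ball[of z k m] k by blast
    then have b: "b z \<in> F m" "z \<in> cball (b z) (r m)"
      unfolding b_def by (metis (mono_tags, lifting) someI_ex)+
    then have c': "c (b z) \<in> A \<inter> cball (b z) (r m)" using c[of z] k by blast
    have zE: "z \<in> cball (b z) (r m) \<inter> E" using b k limit_set_subset by blast
    have "dist (c (b z)) z < 2 * inverse (real (Suc m))"
      using c' b r_small[of m] dist_triangle3[of "c (b z)" z "b z"] by auto
    moreover have "dist ((T ^^ (j * q)) z) (g j (c (b z))) < inverse (real (Suc m))"
      if "j \<in> {1..d}" for j
      using q(2)[OF b(1) _ zE, of j] that assms(2) c' by (auto simp: t_def)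
    ultimately show ?thesis using c' by blast
  qed
  with q show ?thesis by (intro exI[of _ q] conjI exI[of _ "\<lambda>z. c (b z)"]) auto
qed

lemma approximation:
  assumes "\<And>j. j \<in> {1..d} \<Longrightarrow> g j \<in> A \<rightarrow> E"
  obtains q a where "strict_mono q" "\<And>i. 0 < q i"
    "\<And>i k z. \<lbrakk>k \<le> i; d \<le> i; z \<in> A \<inter> limit_set k\<rbrakk> \<Longrightarrow>
      a i z \<in> A \<and> dist (a i z) z < 2 * inverse (real (Suc i)) \<and>
      (\<forall>j\<in>{1..d}. dist ((T ^^ (j * q i)) z) (g j (a i z)) < inverse (real (Suc i)))"
proof -
  \<comment> \<open>Stages below \<open>d\<close> may not control all exponents up to
    \<open>d\<close>; there only the lower bound on \<open>q\<close> is kept.\<close>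
  have "\<exists>q a. m \<le> q \<and> (d \<le> m \<longrightarrow> (\<forall>k\<le>m. \<forall>z\<in>A \<inter> limit_set k.
      a z \<in> A \<and> dist (a z) z < 2 * inverse (real (Suc m)) \<and>
      (\<forall>j\<in>{1..d}. dist ((T ^^ (j * q)) z) (g j (a z)) < inverse (real (Suc m)))))" for m
  proof (cases "d \<le> m")
    case True
    then show ?thesis using approximation_stage[of d g A m] assms True by blast
  qed auto
  then obtain q a where q: "\<And>m. m \<le> q m" and
    a: "\<And>m k z. \<lbrakk>d \<le> m; k \<le> m; z \<in> A \<inter> limit_set k\<rbrakk> \<Longrightarrow>
      a m z \<in> A \<and> dist (a m z) z < 2 * inverse (real (Suc m)) \<and>
      (\<forall>j\<in>{1..d}. dist ((T ^^ (j * q m)) z) (g j (a m z)) < inverse (real (Suc m)))"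
    by metis
  obtain s :: "nat \<Rightarrow> nat" where s: "strict_mono s" "strict_mono (q \<circ> s)" "\<And>i. 0 < q (s i)"
    using strict_mono_subsequence[OF q] by blast
  show ?thesis
  proof (rule that[of "q \<circ> s" "a \<circ> s"])
    fix i k z assume i: "k \<le> i" "d \<le> i" "z \<in> A \<inter> limit_set k"
    \<comment> \<open>The bounds at stage \<open>s i\<close> are at least as strong as those wanted
      at index \<open>i\<close>.\<close>
    have "i \<le> s i" using s(1) by (rule strict_mono_imp_increasing)
    moreover from this have "inverse (real (Suc (s i))) \<le> inverse (real (Suc i))"
      by (intro le_imp_inverse_le) auto
    moreover from \<open>i \<le> s i\<close> i have "d \<le> s i" "k \<le> s i" by linarith+
    note a[OF this i(3)]
    ultimately show "(a \<circ> s) i z \<in> A \<and> dist ((a \<circ> s) i z) z < 2 * inverse (real (Suc i)) \<and>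
      (\<forall>j\<in>{1..d}. dist ((T ^^ (j * (q \<circ> s) i)) z) (g j ((a \<circ> s) i z)) < inverse (real (Suc i)))"
      unfolding comp_apply by (meson mult_left_mono order_less_le_trans zero_le_numeral)
  qed (use s in auto)
qed

text \<open>The representatives \<open>a i x\<close> stay in \<open>A\<close> and tend to
  \<open>x\<close>, so continuity at \<open>x\<close> carries the approximation of
  \<open>g j (a i x)\<close> over to \<open>g j x\<close>. The starting index depends on a
  \<open>k\<close> with \<open>x\<close> in \<open>limit_set k\<close>, so the convergence is only
  pointwise.\<close>

lemma pointwise_realization:
  assumes A: "A \<subseteq> (\<Union>k. limit_set k)"
    and g: "\<And>j. j \<in> {1..d} \<Longrightarrow> continuous_on A (g j) \<and> g j \<in> A \<rightarrow> E"
  shows "\<exists>q :: nat \<Rightarrow> nat. strict_mono q \<and> (\<forall>i. 0 < q i) \<and>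
    (\<forall>x\<in>A. \<forall>j\<in>{1..d}. (\<lambda>i. (T ^^ (j * q i)) x) \<longlonglongrightarrow> g j x)"
proof -
  obtain q a where q: "strict_mono q" "\<And>i. 0 < q i" and
    a: "\<And>i k z. \<lbrakk>k \<le> i; d \<le> i; z \<in> A \<inter> limit_set k\<rbrakk> \<Longrightarrow>
      a i z \<in> A \<and> dist (a i z) z < 2 * inverse (real (Suc i)) \<and>
      (\<forall>j\<in>{1..d}. dist ((T ^^ (j * q i)) z) (g j (a i z)) < inverse (real (Suc i)))"
    using approximation[of d g A] g by blast
  have "(\<lambda>i. (T ^^ (j * q i)) x) \<longlonglongrightarrow> g j x" if x: "x \<in> A" and j: "j \<in> {1..d}" for x j
    unfolding lim_sequentially
  proof (intro allI impI)
    fix e :: real assume e: "0 < e"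
    then obtain \<delta> where \<delta>: "0 < \<delta>" "\<And>y. \<lbrakk>y \<in> A; dist y x < \<delta>\<rbrakk> \<Longrightarrow> dist (g j y) (g j x) < e / 2"
      using g[OF j] x unfolding continuous_on_iff by (meson half_gt_zero)
    obtain k where k: "x \<in> limit_set k" using A x by blast
    obtain N where N: "inverse (real (Suc N)) < min (e / 2) (\<delta> / 2)"
      using reals_Archimedean[of "min (e / 2) (\<delta> / 2)"] e \<delta> by auto
    have "dist ((T ^^ (j * q i)) x) (g j x) < e" if i: "max N (max k d) \<le> i" for i
    proof -
      have "inverse (real (Suc i)) \<le> inverse (real (Suc N))" using i by (intro le_imp_inverse_le) auto
      with N have small: "inverse (real (Suc i)) < e / 2" "2 * inverse (real (Suc i)) < \<delta>"
        unfolding min_less_iff_conj by linarith+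
      have "x \<in> A \<inter> limit_set k" using x k by blast
      then have a': "a i x \<in> A" "dist (a i x) x < 2 * inverse (real (Suc i))"
        "dist ((T ^^ (j * q i)) x) (g j (a i x)) < inverse (real (Suc i))"
        using a[of k i x] i j by simp_all
      have "dist (g j (a i x)) (g j x) < e / 2"
        using \<delta>(2)[of "a i x"] a'(1,2) small(2) x by simp
      moreover have "dist ((T ^^ (j * q i)) x) (g j (a i x)) < e / 2"
        using a'(3) small(1) by linarith
      ultimately show ?thesis
        using dist_triangle[of "(T ^^ (j * q i)) x" "g j x" "g j (a i x)"] by linarith
    qed
    then show "\<exists>no. \<forall>n\<ge>no. dist ((T ^^ (j * q n)) x) (g j x) < e" by blast
  qed
  with q show ?thesis by blast
qed

text \<open>Here one \<open>k\<close> serves all of \<open>B\<close>, and compactness of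
  \<open>B\<close> gives a modulus of continuity independent of the point.\<close>

lemma uniform_realization:
  assumes B: "closedin (top_of_set (limit_set k)) B"
    and h: "\<And>j. j \<in> {1..d} \<Longrightarrow> continuous_on B (h j) \<and> h j \<in> B \<rightarrow> E"
  shows "\<exists>q :: nat \<Rightarrow> nat. strict_mono q \<and> (\<forall>i. 0 < q i) \<and>
    uniform_limit (B \<times> {1..d}) (\<lambda>i (x, j). (T ^^ (j * q i)) x) (\<lambda>(x, j). h j x) sequentially"
proof -
  obtain q a where q: "strict_mono q" "\<And>i. 0 < q i" and
    a: "\<And>i k z. \<lbrakk>k \<le> i; d \<le> i; z \<in> B \<inter> limit_set k\<rbrakk> \<Longrightarrow>
      a i z \<in> B \<and> dist (a i z) z < 2 * inverse (real (Suc i)) \<and>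
      (\<forall>j\<in>{1..d}. dist ((T ^^ (j * q i)) z) (h j (a i z)) < inverse (real (Suc i)))"
    using approximation[of d h B] h by blast
  have Bk: "B \<subseteq> limit_set k" using B closedin_imp_subset by blast
  have "compact B" using closedin_compact[OF compact_limit_set B] .
  have ev: "\<forall>\<^sub>F i in sequentially. \<forall>x\<in>B. dist ((T ^^ (j * q i)) x) (h j x) < e"
    if e: "0 < e" and j: "j \<in> {1..d}" for e j
  proof -
    have "uniformly_continuous_on B (h j)"
      using compact_uniformly_continuous \<open>compact B\<close> h[OF j] by blast
    then obtain \<delta> where \<delta>: "0 < \<delta>"
      "\<And>x y. \<lbrakk>x \<in> B; y \<in> B; dist y x < \<delta>\<rbrakk> \<Longrightarrow> dist (h j y) (h j x) < e / 2"
      using e unfolding uniformly_continuous_on_def by (meson half_gt_zero)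
    obtain N where N: "inverse (real (Suc N)) < min (e / 2) (\<delta> / 2)"
      using reals_Archimedean[of "min (e / 2) (\<delta> / 2)"] e \<delta> by auto
    have "dist ((T ^^ (j * q i)) x) (h j x) < e" if i: "max N (max k d) \<le> i" and x: "x \<in> B" for i x
    proof -
      have "inverse (real (Suc i)) \<le> inverse (real (Suc N))" using i by (intro le_imp_inverse_le) auto
      with N have small: "inverse (real (Suc i)) < e / 2" "2 * inverse (real (Suc i)) < \<delta>"
        unfolding min_less_iff_conj by linarith+
      have "x \<in> B \<inter> limit_set k" using x Bk by blast
      then have a': "a i x \<in> B" "dist (a i x) x < 2 * inverse (real (Suc i))"
        "dist ((T ^^ (j * q i)) x) (h j (a i x)) < inverse (real (Suc i))"
        using a[of k i x] i j by simp_all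
      have "dist (h j (a i x)) (h j x) < e / 2"
        using \<delta>(2)[of x "a i x"] a'(1,2) small(2) x by simp
      moreover have "dist ((T ^^ (j * q i)) x) (h j (a i x)) < e / 2"
        using a'(3) small(1) by linarith
      ultimately show ?thesis
        using dist_triangle[of "(T ^^ (j * q i)) x" "h j x" "h j (a i x)"] by linarith
    qed
    then show ?thesis by (intro eventually_sequentiallyI) blast
  qed
  have "uniform_limit (B \<times> {1..d}) (\<lambda>i (x, j). (T ^^ (j * q i)) x) (\<lambda>(x, j). h j x) sequentially"
    unfolding uniform_limit_iff
  proof (intro allI impI)
    fix e :: real assume "0 < e"
    with ev have "\<forall>\<^sub>F i in sequentially. \<forall>j\<in>{1..d}. \<forall>x\<in>B. dist ((T ^^ (j * q i)) x) (h j x) < e"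
      by (intro eventually_ball_finite) auto
    then show "\<forall>\<^sub>F i in sequentially. \<forall>p\<in>B \<times> {1..d}.
        dist (case p of (x, j) \<Rightarrow> (T ^^ (j * q i)) x) (case p of (x, j) \<Rightarrow> h j x) < e"
      by eventually_elim auto
  qed
  with q show ?thesis by blast
qed

end

section \<open>Constructing a steered scheme\<close>

lemma finite_common_radius:
  fixes Q :: "'b \<Rightarrow> real \<Rightarrow> bool"
  assumes "finite I" "\<And>i. i \<in> I \<Longrightarrow> \<exists>\<rho>>0. Q i \<rho>"
    and "\<And>i \<rho> \<rho>'. \<lbrakk>i \<in> I; Q i \<rho>; 0 < \<rho>'; \<rho>' \<le> \<rho>\<rbrakk> \<Longrightarrow> Q i \<rho>'"
  obtains \<rho> where "0 < \<rho>" "\<And>i. i \<in> I \<Longrightarrow> Q i \<rho>"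
proof -
  obtain R where R: "\<And>i. i \<in> I \<Longrightarrow> 0 < R i \<and> Q i (R i)" using assms(2) by metis
  \<comment> \<open>The extra 1 covers an empty \<open>I\<close>.\<close>
  define \<rho> where "\<rho> = Min (insert 1 (R ` I))"
  have "0 < \<rho>" using assms(1) R unfolding \<rho>_def by (subst Min_gr_iff) auto
  moreover have "\<rho> \<le> R i" if "i \<in> I" for i using assms(1) that unfolding \<rho>_def by auto
  ultimately show ?thesis using R assms(3) that by blast
qed

section \<open>Return times and refinement of balls in a mixing set\<close>

locale delta_mixing =
  fixes X E :: "'a::metric_space set" and T :: "'a \<Rightarrow> 'a"
  assumes system: "dynamical_system X T"
    and mixing: "delta_weakly_mixing X T E"
begin

lemma E_subset: "E \<subseteq> X"
  using mixing closedin_imp_subset unfolding delta_weakly_mixing_def by blast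

lemma compact_E: "compact E"
  using mixing system closedin_compact unfolding delta_weakly_mixing_def dynamical_system_def by blast

lemma funpow_in: "x \<in> X \<Longrightarrow> (T ^^ n) x \<in> X"
  using system unfolding dynamical_system_def by (induction n) auto

lemma continuous_on_funpow: "continuous_on X (T ^^ n)"
proof (induction n)
  case (Suc n)
  have "(T ^^ n) ` X \<subseteq> X" using funpow_in by blast
  then have "continuous_on ((T ^^ n) ` X) T"
    using system continuous_on_subset unfolding dynamical_system_def by blast
  with Suc show ?case unfolding funpow.simps by (rule continuous_on_compose)
qed (simp add: continuous_on_id id_def)

lemma ball_meets_E: "\<lbrakk>x \<in> E; 0 < e\<rbrakk> \<Longrightarrow> openin (top_of_set X) (X \<inter> ball x e) \<and> X \<inter> ball x e \<inter> E \<noteq> {}"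
  using E_subset by (auto intro: openin_open_Int)

text \<open>Mixing in the form used below: any finite index set, sources \<open>V\<close> kept apart
  from targets \<open>U\<close>, and exponents counted from 1.\<close>

lemma common_time:
  assumes I: "finite I" "I \<noteq> {}" and d: "1 \<le> d"
    and V: "\<And>i. i \<in> I \<Longrightarrow> openin (top_of_set X) (V i) \<and> V i \<inter> E \<noteq> {}"
    and U: "\<And>i j. \<lbrakk>i \<in> I; j \<in> {1..d}\<rbrakk> \<Longrightarrow> openin (top_of_set X) (U i j) \<and> U i j \<inter> E \<noteq> {}"
  obtains q x where "1 \<le> q" "\<And>i. i \<in> I \<Longrightarrow> x i \<in> V i \<inter> E"
    "\<And>i j. \<lbrakk>i \<in> I; j \<in> {1..d}\<rbrakk> \<Longrightarrow> (T ^^ (j * q)) (x i) \<in> U i j"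
proof -
  obtain h where h: "bij_betw h {1..card I} I" using ex_bij_betw_nat_finite_1[OF I(1)] by blast
  \<comment> \<open>The source occupies slot 1, and slot \<open>j + 1\<close> carries the target for
    exponent \<open>j\<close>; hence \<open>Suc d\<close> slots.\<close>
  define W where "W i j = (if j = 1 then V (h i) else U (h i) (j - 1))" for i j :: nat
  have "openin (top_of_set X) (W i j) \<and> W i j \<inter> E \<noteq> {}" if ij: "i \<in> {1..card I}" "j \<in> {1..Suc d}" for i j
  proof -
    have "h i \<in> I" using bij_betwE[OF h] ij(1) by blast
    moreover have "j = 1 \<or> j - 1 \<in> {1..d}" using ij(2) by auto
    ultimately show ?thesis using V[of "h i"] U[of "h i" "j - 1"] unfolding W_def by auto
  qed
  moreover have "1 \<le> card I" using I by (simp add: Suc_leI card_gt_0_iff)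
  ultimately have "(\<Inter>i\<in>{1..card I}. return_times X T (Suc d)
      (\<lambda>j. if j = 1 then W i 1 \<inter> E else W i j)) \<noteq> {}"
    using mixing d unfolding delta_weakly_mixing_def by auto
  then obtain q where "q \<in> (\<Inter>i\<in>{1..card I}. return_times X T (Suc d)
      (\<lambda>j. if j = 1 then W i 1 \<inter> E else W i j))"
    unfolding ex_in_conv[symmetric] by (rule exE)
  from INT_D[OF this] have q: "q \<in> return_times X T (Suc d) (\<lambda>j. if j = 1 then W i 1 \<inter> E else W i j)"
    if "i \<in> {1..card I}" for i
    using that .
  have "\<exists>x\<in>V p \<inter> E. \<forall>j\<in>{1..d}. (T ^^ (j * q)) x \<in> U p j" if "p \<in> I" for p
  proof -
    have "p \<in> h ` {1..card I}" using that unfolding bij_betw_imp_surj_on[OF h] .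
    then obtain i where i: "i \<in> {1..card I}" "p = h i" by (auto elim!: imageE)
    have "(\<Inter>j\<in>{1..Suc d}. {x \<in> X. (T ^^ ((j - 1) * q)) x \<in> (if j = 1 then W i 1 \<inter> E else W i j)}) \<noteq> {}"
      using q[OF i(1)] unfolding return_times_def mem_Collect_eq by (rule conjunct2)
    then obtain x where "x \<in> (\<Inter>j\<in>{1..Suc d}.
        {x \<in> X. (T ^^ ((j - 1) * q)) x \<in> (if j = 1 then W i 1 \<inter> E else W i j)})"
      unfolding ex_in_conv[symmetric] by (rule exE)
    then have x: "(T ^^ ((j - 1) * q)) x \<in> (if j = 1 then W i 1 \<inter> E else W i j)"
      if "j \<in> {1..Suc d}" for j
      using INT_D[OF _ that] by fast
    have "x \<in> V p \<inter> E" using x[of 1] i by (simp add: W_def)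
    moreover have "(T ^^ (j * q)) x \<in> U p j" if "j \<in> {1..d}" for j
      using x[of "Suc j"] that i by (simp add: W_def)
    ultimately show ?thesis by blast
  qed
  then obtain x where "\<And>p. p \<in> I \<Longrightarrow> x p \<in> V p \<inter> E \<and> (\<forall>j\<in>{1..d}. (T ^^ (j * q)) (x p) \<in> U p j)"
    by metis
  moreover have "1 \<le> q" using q[of 1] \<open>1 \<le> card I\<close> unfolding return_times_def by simp
  ultimately show ?thesis using that by blast
qed

text \<open>Two disjoint targets for the same source show that the source is not a single point.\<close>

lemma islimpt_E:
  assumes x: "x \<in> E"
  shows "x islimpt E"
proof (rule ccontr)
  assume "\<not> x islimpt E"
  then obtain \<delta> where \<delta>: "0 < \<delta>" "\<And>y. \<lbrakk>y \<in> E; dist y x < \<delta>\<rbrakk> \<Longrightarrow> y = x"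
    unfolding islimpt_approachable by blast
  obtain y where y: "y \<in> E" "y \<noteq> x" using mixing x unfolding delta_weakly_mixing_def by metis
  \<comment> \<open>With half the distance as radius, the balls about \<open>x\<close> and
    \<open>y\<close> are disjoint, yet an isolated \<open>x\<close> would have to be sent into both
    by the same iterate.\<close>
  define e where "e = dist x y / 2"
  have e: "0 < e" using y by (simp add: e_def)
  obtain q z where z: "\<And>b. z b \<in> X \<inter> ball x \<delta> \<inter> E"
    "\<And>b. (T ^^ (1 * q)) (z b) \<in> (if b then X \<inter> ball x e else X \<inter> ball y e)"
    by (rule common_time[of "UNIV :: bool set" 1 "\<lambda>_. X \<inter> ball x \<delta>"
        "\<lambda>b _. if b then X \<inter> ball x e else X \<inter> ball y e"])
      (use ball_meets_E[OF x \<delta>(1)] ball_meets_E[OF x e] ball_meets_E[OF y(1) e] in auto)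
  have "z b = x" for b using z(1)[of b] \<delta>(2)[of "z b"] by (simp add: dist_commute)
  with z(2)[of True] z(2)[of False] have "dist x ((T ^^ q) x) < e" "dist y ((T ^^ q) x) < e" by auto
  then show False using dist_triangle2[of x y "(T ^^ q) x"] unfolding e_def by simp
qed

lemma infinite_E: "infinite E"
  using islimpt_E mixing islimpt_finite unfolding delta_weakly_mixing_def by blast

text \<open>To force a large common time, add a source whose first \<open>M\<close> iterates all miss its target.\<close>

lemma late_common_time:
  assumes P: "finite P" "\<And>p. p \<in> P \<Longrightarrow> f p \<in> E" and d: "1 \<le> d" and pos: "0 < r" "0 < e"
    and t: "\<And>p j. \<lbrakk>p \<in> P; j \<in> {1..d}\<rbrakk> \<Longrightarrow> t p j \<in> E"
  obtains q x where "M \<le> q" "\<And>p. p \<in> P \<Longrightarrow> x p \<in> ball (f p) r \<inter> E"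
    "\<And>p j. \<lbrakk>p \<in> P; j \<in> {1..d}\<rbrakk> \<Longrightarrow> dist ((T ^^ (j * q)) (x p)) (t p j) < e"
proof -
  obtain x0 where x0: "x0 \<in> E" using infinite_E by fastforce
  let ?O = "(\<lambda>k. (T ^^ k) x0) ` {..M}"
  \<comment> \<open>\<open>E\<close> is infinite, so some point of it avoids the finite orbit
    segment.\<close>
  obtain y where y: "y \<in> E" "y \<notin> ?O"
    using infinite_E by (metis finite_atMost finite_imageI finite_subset subsetI)
  obtain \<delta> where \<delta>: "0 < \<delta>" "\<And>u. \<lbrakk>u \<in> ?O; u \<noteq> y\<rbrakk> \<Longrightarrow> \<delta> \<le> dist y u"
    using finite_set_avoid[of ?O y] by blast
  \<comment> \<open>An open neighbourhood of \<open>x0\<close> in \<open>X\<close> whose iterates up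
    to time \<open>M\<close> stay away from \<open>y\<close>.\<close>
  define V0 where "V0 = (\<Inter>k\<in>{..M}. X \<inter> (T ^^ k) -` (- cball y (\<delta> / 2)))"
  have "openin (top_of_set X) V0"
    unfolding V0_def
    by (intro openin_INT2 continuous_openin_preimage_gen continuous_on_funpow) auto
  moreover have "x0 \<in> V0"
    using x0 E_subset \<delta> y(2) unfolding V0_def by force
  ultimately have V0: "openin (top_of_set X) V0 \<and> V0 \<inter> E \<noteq> {}" using x0 by blast
  \<comment> \<open>\<open>None\<close> indexes the extra source with target near \<open>y\<close>,
    and \<open>Some p\<close> the given data.\<close>
  define V where "V i = (case i of None \<Rightarrow> V0 | Some p \<Rightarrow> X \<inter> ball (f p) r)" for i
  define U where "U i j = (case i of None \<Rightarrow> X \<inter> ball y (\<delta> / 2) | Some p \<Rightarrow> X \<inter> ball (t p j) e)"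
    for i and j :: nat
  obtain q z where q: "1 \<le> q" and z: "\<And>i. i \<in> insert None (Some ` P) \<Longrightarrow> z i \<in> V i \<inter> E"
    "\<And>i j. \<lbrakk>i \<in> insert None (Some ` P); j \<in> {1..d}\<rbrakk> \<Longrightarrow> (T ^^ (j * q)) (z i) \<in> U i j"
  proof (rule common_time[of "insert None (Some ` P)" d V U])
    show "openin (top_of_set X) (V i) \<and> V i \<inter> E \<noteq> {}" if "i \<in> insert None (Some ` P)" for i
      using that V0 ball_meets_E[OF P(2) pos(1)] by (auto simp: V_def)
    show "openin (top_of_set X) (U i j) \<and> U i j \<inter> E \<noteq> {}"
      if "i \<in> insert None (Some ` P)" "j \<in> {1..d}" for i j
      using that ball_meets_E[OF y(1)] \<delta>(1) ball_meets_E[OF t pos(2)] by (auto simp: U_def)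
  qed (use P d in auto)
  have "M < q"
  proof (rule ccontr)
    assume "\<not> M < q"
    moreover have "z None \<in> V0" using z(1)[of None] by (simp add: V_def)
    ultimately have "(T ^^ q) (z None) \<notin> cball y (\<delta> / 2)" unfolding V0_def by auto
    moreover have "(T ^^ q) (z None) \<in> ball y (\<delta> / 2)" using z(2)[of None 1] d by (simp add: U_def)
    ultimately show False by simp
  qed
  show ?thesis
  proof (rule that[of q "\<lambda>p. z (Some p)"])
    show "z (Some p) \<in> ball (f p) r \<inter> E" if "p \<in> P" for p
      using z(1)[of "Some p"] that by (simp add: V_def)
    show "dist ((T ^^ (j * q)) (z (Some p))) (t p j) < e" if "p \<in> P" "j \<in> {1..d}" for p j
      using z(2)[of "Some p" j] that by (simp add: U_def dist_commute)
  qed (use \<open>M < q\<close> in simp)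
qed

text \<open>The points \<open>x p\<close> supplied by mixing become the new centres. Only finitely
  many continuous iterates are involved, so the strict inequalities at these points persist on balls
  of one common radius.\<close>

lemma refine_one:
  assumes P: "finite P" "\<And>p. p \<in> P \<Longrightarrow> f p \<in> E" and d: "1 \<le> d" and pos: "0 < r" "0 < e"
    and t: "\<And>p j. \<lbrakk>p \<in> P; j \<in> {1..d}\<rbrakk> \<Longrightarrow> t p j \<in> E"
  obtains q f' r' where "M \<le> q" "0 < r'" "r' \<le> r"
    "\<And>p. p \<in> P \<Longrightarrow> f' p \<in> E \<and> cball (f' p) r' \<subseteq> ball (f p) r"
    "\<And>p j y. \<lbrakk>p \<in> P; j \<in> {1..d}; y \<in> cball (f' p) r' \<inter> E\<rbrakk> \<Longrightarrow> dist ((T ^^ (j * q)) y) (t p j) < e"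
proof -
  obtain q x where q: "M \<le> q" and x: "\<And>p. p \<in> P \<Longrightarrow> x p \<in> ball (f p) r \<inter> E"
    and close: "\<And>p j. \<lbrakk>p \<in> P; j \<in> {1..d}\<rbrakk> \<Longrightarrow> dist ((T ^^ (j * q)) (x p)) (t p j) < e"
    using late_common_time[of P f d r e t M] P d pos t by blast
  obtain \<rho> where \<rho>: "0 < \<rho>" "\<And>p. p \<in> P \<Longrightarrow> cball (x p) \<rho> \<subseteq> ball (f p) r"
  proof (rule finite_common_radius[of P "\<lambda>p \<rho>. cball (x p) \<rho> \<subseteq> ball (f p) r"])
    show "\<exists>\<rho>>0. cball (x p) \<rho> \<subseteq> ball (f p) r" if "p \<in> P" for p
      using x[OF that] open_contains_cball[of "ball (f p) r"] by blast
  qed (use P in auto)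
  let ?Q = "\<lambda>i \<rho>. \<forall>y\<in>cball (x (fst i)) \<rho> \<inter> E. dist ((T ^^ (snd i * q)) y) (t (fst i) (snd i)) < e"
  obtain \<sigma> where \<sigma>: "0 < \<sigma>" "\<And>i. i \<in> P \<times> {1..d} \<Longrightarrow> ?Q i \<sigma>"
  proof (rule finite_common_radius[of "P \<times> {1..d}" ?Q])
    fix i assume i: "i \<in> P \<times> {1..d}"
    then obtain p j where pj: "i = (p, j)" "p \<in> P" "j \<in> {1..d}" by blast
    \<comment> \<open>The slack in the strict inequality at \<open>x p\<close>, to be spent on
      continuity.\<close>
    define \<eta> where "\<eta> = e - dist ((T ^^ (j * q)) (x p)) (t p j)"
    have "0 < \<eta>" using close[OF pj(2,3)] by (simp add: \<eta>_def)
    moreover have "x p \<in> E" using x[OF pj(2)] by blast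
    moreover have "continuous_on E (T ^^ (j * q))"
      using continuous_on_subset[OF continuous_on_funpow E_subset] .
    ultimately obtain \<delta> where \<delta>: "0 < \<delta>"
      "\<And>y. \<lbrakk>y \<in> E; dist y (x p) < \<delta>\<rbrakk> \<Longrightarrow> dist ((T ^^ (j * q)) y) ((T ^^ (j * q)) (x p)) < \<eta>"
      unfolding continuous_on_iff by metis
    have "dist ((T ^^ (j * q)) y) (t p j) < e" if "y \<in> cball (x p) (\<delta> / 2) \<inter> E" for y
    proof -
      have "dist ((T ^^ (j * q)) y) ((T ^^ (j * q)) (x p)) < \<eta>"
        using that \<delta>(1) by (intro \<delta>(2)) (auto simp: dist_commute)
      then show ?thesis
        using dist_triangle[of "(T ^^ (j * q)) y" "t p j" "(T ^^ (j * q)) (x p)"] by (simp add: \<eta>_def)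
    qed
    with \<delta>(1) pj show "\<exists>\<rho>>0. ?Q i \<rho>" by (intro exI[of _ "\<delta> / 2"]) auto
  next
    fix i \<rho> \<rho>' assume *: "?Q i \<rho>" "\<rho>' \<le> \<rho>"
    from *(2) have "cball (x (fst i)) \<rho>' \<subseteq> cball (x (fst i)) \<rho>" by (rule subset_cball)
    with *(1) show "?Q i \<rho>'" by blast
  qed (use P in auto)
  define r' where "r' = min r (min \<rho> \<sigma>)"
  have sub: "cball (x p) r' \<subseteq> cball (x p) \<rho>" "cball (x p) r' \<subseteq> cball (x p) \<sigma>" for p
    by (auto simp: r'_def)
  show ?thesis
  proof (rule that[of q r' x])
    show "0 < r'" "r' \<le> r" using pos \<rho>(1) \<sigma>(1) by (auto simp: r'_def)
    show "x p \<in> E \<and> cball (x p) r' \<subseteq> ball (f p) r" if "p \<in> P" for p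
      using x[OF that] \<rho>(2)[OF that] sub(1)[of p] by blast
    show "dist ((T ^^ (j * q)) y) (t p j) < e" if "p \<in> P" "j \<in> {1..d}" "y \<in> cball (x p) r' \<inter> E" for p j y
      using \<sigma>(2)[of "(p, j)"] that sub(2)[of p] by auto
  qed (rule q)
qed

text \<open>Treat the assignments one at a time: new balls lie inside the old ones, so the times
  found earlier keep working.\<close>

lemma refine_many:
  assumes "finite \<Theta>" and P: "finite P" "P \<subseteq> E" and d: "1 \<le> d" and pos: "0 < r" "0 < e"
    and t: "\<forall>t\<in>\<Theta>. \<forall>p\<in>P. \<forall>j\<in>{1..d}. t p j \<in> E"
  shows "\<exists>f r'. 0 < r' \<and> r' < r \<and> (\<forall>p\<in>P. f p \<in> E \<and> cball (f p) r' \<subseteq> ball p r) \<and>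
    (\<forall>t\<in>\<Theta>. \<exists>q\<ge>M. \<forall>p\<in>P. \<forall>j\<in>{1..d}. \<forall>y\<in>cball (f p) r' \<inter> E. dist ((T ^^ (j * q)) y) (t p j) < e)"
  using assms(1) t
proof (induction \<Theta>)
  case empty
  \<comment> \<open>Halving makes the new radius strictly smaller even when no assignment is
    imposed.\<close>
  have "cball p (r / 2) \<subseteq> ball p r" for p :: 'a using pos by auto
  then show ?case using P pos by (intro exI[of _ "\<lambda>p. p"] exI[of _ "r / 2"]) auto
next
  case (insert \<theta> \<Theta>)
  from insert.prems have "\<forall>t\<in>\<Theta>. \<forall>p\<in>P. \<forall>j\<in>{1..d}. t p j \<in> E" "\<forall>p\<in>P. \<forall>j\<in>{1..d}. \<theta> p j \<in> E"
    by simp_all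
  note prems = this
  from insert.IH[OF prems(1)] obtain f r1 where f: "0 < r1" "r1 < r" "\<And>p. p \<in> P \<Longrightarrow> f p \<in> E \<and> cball (f p) r1 \<subseteq> ball p r"
    and old: "\<And>t. t \<in> \<Theta> \<Longrightarrow>
      \<exists>q\<ge>M. \<forall>p\<in>P. \<forall>j\<in>{1..d}. \<forall>y\<in>cball (f p) r1 \<inter> E. dist ((T ^^ (j * q)) y) (t p j) < e"
    by blast
  obtain q f' r' where q: "M \<le> q" and r': "0 < r'" "r' \<le> r1"
    and f': "\<And>p. p \<in> P \<Longrightarrow> f' p \<in> E \<and> cball (f' p) r' \<subseteq> ball (f p) r1"
    and new: "\<And>p j y. \<lbrakk>p \<in> P; j \<in> {1..d}; y \<in> cball (f' p) r' \<inter> E\<rbrakk> \<Longrightarrow>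
      dist ((T ^^ (j * q)) y) (\<theta> p j) < e"
    by (rule refine_one[of P f d r1 e \<theta> M]) (use P(1) f(1,3) d pos prems(2) in auto)
  have sub: "cball (f' p) r' \<subseteq> cball (f p) r1" if "p \<in> P" for p
    using f'[OF that] ball_subset_cball by blast
  show ?case
  proof (rule exI[of _ f'], rule exI[of _ r'], intro conjI ballI)
    fix t assume "t \<in> insert \<theta> \<Theta>"
    then consider "t = \<theta>" | "t \<in> \<Theta>" by blast
    then show "\<exists>q\<ge>M. \<forall>p\<in>P. \<forall>j\<in>{1..d}. \<forall>y\<in>cball (f' p) r' \<inter> E. dist ((T ^^ (j * q)) y) (t p j) < e"
    proof cases
      case 1
      with q new show ?thesis by blast
    next
      case 2
      from old[OF this] obtain q where "M \<le> q"
        "\<forall>p\<in>P. \<forall>j\<in>{1..d}. \<forall>y\<in>cball (f p) r1 \<inter> E. dist ((T ^^ (j * q)) y) (t p j) < e"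
        by blast
      then show ?thesis using sub by blast
    qed
  next
    show "f' p \<in> E" "cball (f' p) r' \<subseteq> ball p r" if "p \<in> P" for p
      using f'[OF that] f(3)[OF that] sub[OF that] by blast+
  qed (use r' f in auto)
qed

section \<open>Inductive construction of the stages\<close>

lemma finite_net:
  assumes "0 < e"
  obtains N where "finite N" "N \<subseteq> E" "\<And>z. z \<in> E \<Longrightarrow> \<exists>x\<in>N. dist z x < e"
proof -
  obtain N where N: "N \<subseteq> E" "finite N" "E \<subseteq> (\<Union>x\<in>N. ball x e)"
    using compactE_image[OF compact_E, of E "\<lambda>x. ball x e"] assms by force
  then have "\<exists>x\<in>N. dist z x < e" if "z \<in> E" for z using that by (force simp: dist_commute)
  with N that show ?thesis by blast
qed

text \<open>The conditions on a single stage are separated from \<open>splits\<close>, which links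
  two consecutive stages, as dependent choice requires.\<close>

definition stage :: "nat \<Rightarrow> 'a set \<Rightarrow> real \<Rightarrow> bool" where
  "stage m F r \<longleftrightarrow> finite F \<and> F \<subseteq> E \<and> F \<noteq> {} \<and> 0 < r \<and> r < inverse (real (Suc m)) \<and>
    (\<forall>x\<in>F. \<forall>y\<in>F. x \<noteq> y \<longrightarrow> cball x r \<inter> cball y r = {}) \<and>
    (\<forall>z\<in>E. \<exists>x\<in>F. dist z x < 2 * inverse (real (Suc m))) \<and> steered T E m F r"

definition splits :: "'a set \<Rightarrow> real \<Rightarrow> 'a set \<Rightarrow> real \<Rightarrow> bool" where
  "splits F r F' r' \<longleftrightarrow> (\<forall>x\<in>F. \<exists>y\<in>F'. \<exists>z\<in>F'. y \<noteq> z \<and> cball y r' \<subseteq> cball x r \<and> cball z r' \<subseteq> cball x r)"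

text \<open>Start from a finite net of \<open>E\<close>, the old centres, and a second point near
  each old centre; then shrink and move balls around these points. The net gives density, and each
  old centre and its companion give two children. An empty \<open>F\<close> is allowed and yields
  the initial stage.\<close>

lemma next_stage:
  assumes F: "finite F" "F \<subseteq> E" "0 < r"
  shows "\<exists>F' r'. stage m F' r' \<and> splits F r F' r'"
proof -
  define \<epsilon> where "\<epsilon> = inverse (real (Suc m))"
  have "0 < \<epsilon>" by (simp add: \<epsilon>_def)
  obtain N where N: "finite N" "N \<subseteq> E" "\<And>z. z \<in> E \<Longrightarrow> \<exists>x\<in>N. dist z x < \<epsilon> / 2"
    using finite_net[of "\<epsilon> / 2"] \<open>0 < \<epsilon>\<close> by auto
  \<comment> \<open>The companions exist because \<open>E\<close> has no isolated points.\<close>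
  have "\<forall>x\<in>F. \<exists>c\<in>E. c \<noteq> x \<and> dist c x < r"
    using islimpt_E F unfolding islimpt_approachable by blast
  then obtain c where c: "\<And>x. x \<in> F \<Longrightarrow> c x \<in> E \<and> c x \<noteq> x \<and> dist (c x) x < r" by metis
  define P where "P = N \<union> F \<union> c ` F"
  have P: "finite P" "P \<subseteq> E" using N F c unfolding P_def by auto
  obtain \<rho>1 where \<rho>1: "0 < \<rho>1" "\<And>i. i \<in> P \<times> P \<Longrightarrow> fst i \<noteq> snd i \<longrightarrow> 2 * \<rho>1 \<le> dist (fst i) (snd i)"
  proof (rule finite_common_radius[of "P \<times> P" "\<lambda>i \<rho>. fst i \<noteq> snd i \<longrightarrow> 2 * \<rho> \<le> dist (fst i) (snd i)"])
    show "\<exists>\<rho>>0. fst i \<noteq> snd i \<longrightarrow> 2 * \<rho> \<le> dist (fst i) (snd i)" for i :: "'a \<times> 'a"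
      by (cases "fst i = snd i")
        (auto intro: exI[of _ 1] exI[of _ "dist (fst i) (snd i) / 2"])
  qed (use P in auto)
  \<comment> \<open>Room for the ball about the companion inside the old ball.\<close>
  obtain \<rho>2 where \<rho>2: "0 < \<rho>2" "\<And>x. x \<in> F \<Longrightarrow> dist (c x) x + \<rho>2 \<le> r"
  proof (rule finite_common_radius[of F "\<lambda>x \<rho>. dist (c x) x + \<rho> \<le> r"])
    show "\<exists>\<rho>>0. dist (c x) x + \<rho> \<le> r" if "x \<in> F" for x
      using c[OF that] by (intro exI[of _ "r - dist (c x) x"]) auto
  qed (use F in auto)
  define r1 where "r1 = Min {\<epsilon>, \<rho>1, \<rho>2, r}"
  have r1: "0 < r1" "r1 \<le> \<epsilon>" "r1 \<le> \<rho>1" "r1 \<le> \<rho>2" "r1 \<le> r"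
    using \<open>0 < \<epsilon>\<close> \<rho>1(1) \<rho>2(1) F(3) unfolding r1_def by auto
  have disj: "ball p r1 \<inter> ball p' r1 = {}" if "p \<in> P" "p' \<in> P" "p \<noteq> p'" for p p'
    using \<rho>1(2)[of "(p, p')"] that r1(3) by (intro disjoint_ballI) auto
  \<comment> \<open>All assignments of net points; taking extensional functions makes this set
    finite.\<close>
  define \<Theta> where "\<Theta> = (P \<rightarrow>\<^sub>E ({1..Suc m} \<rightarrow>\<^sub>E N))"
  have "finite \<Theta>" unfolding \<Theta>_def using P N by (intro finite_PiE) auto
  moreover have "\<forall>t\<in>\<Theta>. \<forall>p\<in>P. \<forall>j\<in>{1..Suc m}. t p j \<in> E"
    using N(2) unfolding \<Theta>_def by fastforce
  ultimately have "\<exists>f r'. 0 < r' \<and> r' < r1 \<and> (\<forall>p\<in>P. f p \<in> E \<and> cball (f p) r' \<subseteq> ball p r1) \<and>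
      (\<forall>t\<in>\<Theta>. \<exists>q\<ge>m. \<forall>p\<in>P. \<forall>j\<in>{1..Suc m}. \<forall>y\<in>cball (f p) r' \<inter> E.
        dist ((T ^^ (j * q)) y) (t p j) < \<epsilon> / 2)"
    using P r1(1) \<open>0 < \<epsilon>\<close> by (intro refine_many) simp_all
  then obtain f r' where r': "0 < r'" "r' < r1"
    and f: "\<And>p. p \<in> P \<Longrightarrow> f p \<in> E \<and> cball (f p) r' \<subseteq> ball p r1"
    and hit: "\<And>t. t \<in> \<Theta> \<Longrightarrow> \<exists>q\<ge>m. \<forall>p\<in>P. \<forall>j\<in>{1..Suc m}. \<forall>y\<in>cball (f p) r' \<inter> E.
      dist ((T ^^ (j * q)) y) (t p j) < \<epsilon> / 2"
    by blast
  have f_ball: "f p \<in> ball p r1" if "p \<in> P" for p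
    using f[OF that] r'(1) by (meson centre_in_cball less_imp_le subsetD)
  have "steered T E m (f ` P) r'"
    unfolding steered_def
  proof (intro allI impI)
    fix t assume t: "\<forall>x\<in>f ` P. \<forall>j\<in>{1..Suc m}. t x j \<in> E"
    then have "\<forall>p\<in>P. \<forall>j\<in>{1..Suc m}. \<exists>n\<in>N. dist (t (f p) j) n < \<epsilon> / 2" using N(3) by blast
    \<comment> \<open>Round arbitrary targets to the net: half of the tolerance is spent here, the
      other half on hitting the net point.\<close>
    then obtain n where n: "\<And>p j. \<lbrakk>p \<in> P; j \<in> {1..Suc m}\<rbrakk> \<Longrightarrow> n p j \<in> N \<and> dist (t (f p) j) (n p j) < \<epsilon> / 2"
      by metis
    have "restrict (\<lambda>p. restrict (n p) {1..Suc m}) P \<in> \<Theta>" using n unfolding \<Theta>_def by auto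
    from hit[OF this] obtain q where q: "m \<le> q" "\<And>p j y. \<lbrakk>p \<in> P; j \<in> {1..Suc m}; y \<in> cball (f p) r' \<inter> E\<rbrakk> \<Longrightarrow>
        dist ((T ^^ (j * q)) y) (restrict (\<lambda>p. restrict (n p) {1..Suc m}) P p j) < \<epsilon> / 2"
      by blast
    have "dist ((T ^^ (j * q)) y) (t (f p) j) < \<epsilon>"
      if "p \<in> P" "j \<in> {1..Suc m}" "y \<in> cball (f p) r' \<inter> E" for p j y
      using q(2)[OF that] n[OF that(1,2)] that(1,2)
        dist_triangle2[of "(T ^^ (j * q)) y" "t (f p) j" "n p j"] by auto
    with q(1) show "\<exists>q\<ge>m. \<forall>x\<in>f ` P. \<forall>j\<in>{1..Suc m}. \<forall>y\<in>cball x r' \<inter> E.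
        dist ((T ^^ (j * q)) y) (t x j) < inverse (real (Suc m))"
      unfolding \<epsilon>_def by blast
  qed
  moreover have "cball x r' \<inter> cball y r' = {}" if xy: "x \<in> f ` P" "y \<in> f ` P" "x \<noteq> y" for x y
  proof -
    obtain p p' where p: "p \<in> P" "p' \<in> P" "x = f p" "y = f p'" using xy by blast
    with xy(3) have "p \<noteq> p'" by auto
    from disj[OF p(1,2) this] f[OF p(1)] f[OF p(2)] p show ?thesis by blast
  qed
  moreover have "\<exists>x\<in>f ` P. dist z x < 2 * \<epsilon>" if z: "z \<in> E" for z
  proof -
    obtain p where p: "p \<in> N" "dist z p < \<epsilon> / 2" using N(3) z by blast
    \<comment> \<open>Refinement moves the net point \<open>p\<close> by less than \<epsilon>, which
      accounts for the factor 2 in the density bound.\<close>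
    then have "dist p (f p) < \<epsilon>" using f_ball[of p] r1(2) by (auto simp: P_def)
    with p \<open>0 < \<epsilon>\<close> dist_triangle[of z "f p" p] have "dist z (f p) < 2 * \<epsilon>" by linarith
    with p show ?thesis unfolding P_def by blast
  qed
  moreover have "f ` P \<noteq> {}" using N(3) infinite_E unfolding P_def by fastforce
  ultimately have "stage m (f ` P) r'"
    unfolding stage_def \<epsilon>_def[symmetric] using P f r' r1(2) by auto
  moreover have "splits F r (f ` P) r'"
    unfolding splits_def
  proof
    fix x assume x: "x \<in> F"
    then have xP: "x \<in> P" "c x \<in> P" by (auto simp: P_def)
    have "ball (c x) r1 \<subseteq> cball x r"
    proof
      fix u assume "u \<in> ball (c x) r1"
      then show "u \<in> cball x r"
        using \<rho>2(2)[OF x] r1(4) dist_triangle[of x u "c x"] by (auto simp: dist_commute)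
    qed
    then have "cball (f (c x)) r' \<subseteq> cball x r" using f[OF xP(2)] by blast
    moreover have "cball (f x) r' \<subseteq> cball x r"
      using f[OF xP(1)] r1(5) by (meson ball_subset_cball order_trans subset_ball)
    \<comment> \<open>The two new centres lie in disjoint balls about \<open>x\<close> and
      \<open>c x\<close>.\<close>
    moreover have "f x \<noteq> f (c x)"
      using f_ball[OF xP(1)] f_ball[OF xP(2)] disj[OF xP] c[OF x] by (metis disjoint_iff)
    ultimately show "\<exists>y\<in>f ` P. \<exists>z\<in>f ` P. y \<noteq> z \<and> cball y r' \<subseteq> cball x r \<and> cball z r' \<subseteq> cball x r"
      using xP by blast
  qed
  ultimately show ?thesis by blast
qed

lemma steered_scheme_exists: "\<exists>F r. steered_scheme E F r T"
proof -
  have "\<exists>s. \<forall>m. stage m (fst (s m)) (snd (s m)) \<and>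
      splits (fst (s m)) (snd (s m)) (fst (s (Suc m))) (snd (s (Suc m)))"
  proof (rule dependent_nat_choice)
    \<comment> \<open>With no old centres, the radius 1 is a dummy.\<close>
    show "\<exists>x. stage 0 (fst x) (snd x)" using next_stage[of "{}" 1 0] by auto
    fix x m assume "stage m (fst x) (snd x)"
    then show "\<exists>y. stage (Suc m) (fst y) (snd y) \<and> splits (fst x) (snd x) (fst y) (snd y)"
      using next_stage[of "fst x" "snd x" "Suc m"] unfolding stage_def by auto
  qed
  then obtain s where s: "\<And>m. stage m (fst (s m)) (snd (s m))"
    "\<And>m. splits (fst (s m)) (snd (s m)) (fst (s (Suc m))) (snd (s (Suc m)))" by blast
  have "steered_scheme E (\<lambda>m. fst (s m)) (\<lambda>m. snd (s m)) T"
  proof unfold_locales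
    show "\<exists>y\<in>fst (s (Suc m)). \<exists>z\<in>fst (s (Suc m)). y \<noteq> z \<and>
        cball y (snd (s (Suc m))) \<subseteq> cball x (snd (s m)) \<and> cball z (snd (s (Suc m))) \<subseteq> cball x (snd (s m))"
      if "x \<in> fst (s m)" for x m
      using s(2)[of m] that unfolding splits_def by blast
  qed (use compact_E s(1) in \<open>auto simp: stage_def\<close>)
  then show ?thesis by blast
qed

end

section \<open>Mixing from approximation on finite sets\<close>

lemma cantor_set_meets_infinite:
  assumes "cantor_set C" "C \<subseteq> E" "openin (top_of_set X) U" "E \<subseteq> X" "U \<inter> C \<noteq> {}"
  shows "infinite (U \<inter> C)"
proof -
  obtain x where x: "x \<in> U" "x \<in> C" using assms by blast
  obtain W where W: "open W" "U = X \<inter> W" using assms(3) by (auto simp: openin_open)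
  have "x islimpt C" using assms(1) x unfolding cantor_set_def by blast
  then have "infinite (C \<inter> W)" using W x by (auto simp: islimpt_eq_acc_point Int_commute[of C])
  moreover have "C \<inter> W \<subseteq> U \<inter> C" using W assms by blast
  ultimately show ?thesis using finite_subset by blast
qed

text \<open>Choose greedily: finitely many earlier choices cannot exhaust an infinite set.
  Distinctness lets values be prescribed independently at the chosen points.\<close>

lemma distinct_representatives:
  assumes "\<And>i. i \<in> {1..n::nat} \<Longrightarrow> infinite (A i)"
  obtains x where "inj_on x {1..n}" "\<And>i. i \<in> {1..n} \<Longrightarrow> x i \<in> A i"
proof -
  have "\<exists>x. inj_on x {1..n} \<and> (\<forall>i\<in>{1..n}. x i \<in> A i)"
    using assms
  proof (induction n)
    case (Suc n)
    then obtain x where x: "inj_on x {1..n}" "\<forall>i\<in>{1..n}. x i \<in> A i" by fastforce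
    have "infinite (A (Suc n))" using Suc.prems[of "Suc n"] by simp
    then obtain a where a: "a \<in> A (Suc n)" "a \<notin> x ` {1..n}"
      by (metis finite_atLeastAtMost finite_imageI finite_subset subsetI)
    define y where "y = x(Suc n := a)"
    have y: "y (Suc n) = a" "\<And>i. i \<in> {1..n} \<Longrightarrow> y i = x i" by (auto simp: y_def)
    have eq: "{1..Suc n} = insert (Suc n) {1..n}" by auto
    have "inj_on y {1..n}" using x(1) y(2) inj_on_cong by blast
    moreover have "y ` ({1..n} - {Suc n}) \<subseteq> x ` {1..n}" using y(2) by auto
    ultimately have "inj_on y {1..Suc n}" unfolding eq inj_on_insert using a(2) y(1) by blast
    moreover have "\<forall>i\<in>{1..Suc n}. y i \<in> A i" unfolding eq using x(2) a(1) y by simp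
    ultimately show ?case by (intro exI conjI)
  qed auto
  then obtain x where "inj_on x {1..n} \<and> (\<forall>i\<in>{1..n}. x i \<in> A i)" by (rule exE)
  then show ?thesis by (intro that[of x]) auto
qed

text \<open>Choose distinct points of the union of the \<open>C k\<close> in the sources and
  prescribe their images in the targets. Every function on a finite set is continuous, so
  \<open>approx\<close> applies, and a late enough time is common to all tuples.\<close>

lemma delta_weakly_mixingI:
  fixes C :: "nat \<Rightarrow> 'a::metric_space set"
  assumes E: "closedin (top_of_set X) E"
    and C: "\<And>k. cantor_set (C k) \<and> C k \<subseteq> E" and dense: "E \<subseteq> closure (\<Union>k. C k)"
    and approx: "\<And>d A g. \<lbrakk>1 \<le> d; A \<subseteq> (\<Union>k. C k); \<And>j. j \<in> {1..d} \<Longrightarrow> continuous_on A (g j) \<and> g j \<in> A \<rightarrow> E\<rbrakk> \<Longrightarrow>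
      \<exists>q. (\<forall>i. 0 < q i) \<and> (\<forall>x\<in>A. \<forall>j\<in>{1..d}. (\<lambda>i::nat. (T ^^ (j * q i)) x) \<longlonglongrightarrow> g j x)"
    and X: "\<And>n. T ^^ n \<in> X \<rightarrow> X"
  shows "delta_weakly_mixing X T E"
proof -
  have EX: "E \<subseteq> X" using E closedin_imp_subset by blast
  \<comment> \<open>By density such a \<open>U\<close> meets some \<open>C k\<close>, and
    perfectness then gives infinitely many points.\<close>
  have inf: "infinite (U \<inter> (\<Union>k. C k))" if U: "openin (top_of_set X) U" "U \<inter> E \<noteq> {}" for U
  proof -
    obtain W where W: "open W" "U = X \<inter> W" using U by (auto simp: openin_open)
    then have "W \<inter> closure (\<Union>k. C k) \<noteq> {}" using U dense by blast
    then have "W \<inter> (\<Union>k. C k) \<noteq> {}" using open_Int_closure_eq_empty[OF W(1)] by blast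
    then obtain k where "U \<inter> C k \<noteq> {}" using W C EX by blast
    then have "infinite (U \<inter> C k)" using cantor_set_meets_infinite[OF _ _ U(1) EX] C by blast
    moreover have "U \<inter> C k \<subseteq> U \<inter> (\<Union>k. C k)" by blast
    ultimately show ?thesis using finite_subset by blast
  qed
  have "\<exists>x\<in>E. \<exists>y\<in>E. x \<noteq> y"
  proof -
    obtain x where "x \<in> C 0" "x islimpt C 0" using C[of 0] unfolding cantor_set_def by blast
    then obtain y where "y \<in> C 0" "y \<noteq> x" unfolding islimpt_approachable by (metis zero_less_one)
    with \<open>x \<in> C 0\<close> C[of 0] show ?thesis by blast
  qed
  moreover have "(\<Inter>i\<in>{1..n}. return_times X T d (\<lambda>j. if j = 1 then U i 1 \<inter> E else U i j)) \<noteq> {}"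
    if n: "1 \<le> n" "2 \<le> d"
      and U: "\<And>i j. \<lbrakk>i \<in> {1..n}; j \<in> {1..d}\<rbrakk> \<Longrightarrow> openin (top_of_set X) (U i j) \<and> U i j \<inter> E \<noteq> {}"
    for n d :: nat and U
  proof -
    obtain x where x: "inj_on x {1..n}" "\<And>i. i \<in> {1..n} \<Longrightarrow> x i \<in> U i 1 \<inter> (\<Union>k. C k)"
      using distinct_representatives[of n "\<lambda>i. U i 1 \<inter> (\<Union>k. C k)"] inf U n by auto
    define y where "y i j = (SOME u. u \<in> U i j \<inter> E)" for i j
    have y: "y i j \<in> U i j \<inter> E" if "i \<in> {1..n}" "j \<in> {1..d}" for i j
      unfolding y_def by (rule someI_ex) (use U[OF that] in blast)
    \<comment> \<open>Injectivity of \<open>x\<close> recovers the index \<open>i\<close> from the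
      point \<open>x i\<close>; exponent \<open>j\<close> belongs to slot
      \<open>j + 1\<close>.\<close>
    define g where "g j u = y (the_inv_into {1..n} x u) (Suc j)" for j u
    have gx: "g j (x i) = y i (Suc j)" if "i \<in> {1..n}" for i j
      using the_inv_into_f_f[OF x(1) that] by (simp add: g_def)
    \<comment> \<open>Slot 1 is the source, so only \<open>d - 1\<close> exponents remain, at least
      one since \<open>d\<close> is at least 2.\<close>
    have "\<exists>q. (\<forall>i. 0 < q i) \<and>
        (\<forall>u\<in>x ` {1..n}. \<forall>j\<in>{1..d - 1}. (\<lambda>i::nat. (T ^^ (j * q i)) u) \<longlonglongrightarrow> g j u)"
    proof (rule approx)
      show "continuous_on (x ` {1..n}) (g j) \<and> g j \<in> x ` {1..n} \<rightarrow> E" if "j \<in> {1..d - 1}" for j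
        using that gx y by (auto intro!: continuous_on_finite)
    qed (use n x in auto)
    then obtain q where q: "\<And>i. 0 < q i"
      "\<And>i j. \<lbrakk>i \<in> {1..n}; j \<in> {1..d - 1}\<rbrakk> \<Longrightarrow> (\<lambda>k::nat. (T ^^ (j * q k)) (x i)) \<longlonglongrightarrow> y i (Suc j)"
      using gx by fastforce
    have xX: "x i \<in> X" if "i \<in> {1..n}" for i using x(2)[OF that] C EX by blast
    have ev: "\<forall>\<^sub>F k in sequentially. (T ^^ (j * q k)) (x i) \<in> U i (Suc j)"
      if ij: "i \<in> {1..n}" "j \<in> {1..d - 1}" for i j
    proof -
      have sj: "Suc j \<in> {1..d}" using ij(2) by auto
      obtain W where W: "open W" "U i (Suc j) = X \<inter> W" using U[OF ij(1) sj] by (auto simp: openin_open)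
      then have "y i (Suc j) \<in> W" using y[OF ij(1) sj] by blast
      with topological_tendstoD[OF q(2)[OF ij] W(1)]
      have "\<forall>\<^sub>F k in sequentially. (T ^^ (j * q k)) (x i) \<in> W" by blast
      then show ?thesis
        by eventually_elim (use W X xX[OF ij(1)] in blast)
    qed
    have "\<forall>\<^sub>F k in sequentially. \<forall>i\<in>{1..n}. \<forall>j\<in>{1..d - 1}. (T ^^ (j * q k)) (x i) \<in> U i (Suc j)"
      using ev by (intro eventually_ball_finite ballI) auto
    then obtain k where k: "\<And>i j. \<lbrakk>i \<in> {1..n}; j \<in> {1..d - 1}\<rbrakk> \<Longrightarrow> (T ^^ (j * q k)) (x i) \<in> U i (Suc j)"
      unfolding eventually_sequentially by blast
    have "q k \<in> return_times X T d (\<lambda>j. if j = 1 then U i 1 \<inter> E else U i j)" if i: "i \<in> {1..n}" for i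
    proof -
      have "(T ^^ ((j - 1) * q k)) (x i) \<in> (if j = 1 then U i 1 \<inter> E else U i j)" if "j \<in> {1..d}" for j
      proof (cases "j = 1")
        case True
        then show ?thesis using x(2)[OF i] C by auto
      next
        case False
        with that have "j - 1 \<in> {1..d - 1}" "Suc (j - 1) = j" by auto
        then show ?thesis using k[OF i, of "j - 1"] False by simp
      qed
      then show ?thesis using q(1)[of k] xX[OF i] unfolding return_times_def by fastforce
    qed
    then show ?thesis by blast
  qed
  ultimately show ?thesis using E unfolding delta_weakly_mixing_def by blast
qed

section \<open>Equivalence of mixing with approximation on Cantor sets\<close>

theorem theoremA:
  fixes X E :: "'a::metric_space set" and T :: "'a \<Rightarrow> 'a"
  assumes "dynamical_system X T"
    and "closedin (top_of_set X) E"
  shows "delta_weakly_mixing X T E \<longleftrightarrow>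
    (\<exists>C :: nat \<Rightarrow> 'a set.
       (\<forall>k. cantor_set (C k) \<and> C k \<subseteq> E \<and> C k \<subseteq> C (Suc k)) \<and>
       E \<subseteq> closure (\<Union>k. C k) \<and>
       (\<forall>d\<ge>1. \<forall>A. \<forall>g :: nat \<Rightarrow> 'a \<Rightarrow> 'a.
          A \<subseteq> (\<Union>k. C k) \<longrightarrow>
          (\<forall>j\<in>{1..d}. continuous_on A (g j) \<and> g j \<in> A \<rightarrow> E) \<longrightarrow>
          (\<exists>q :: nat \<Rightarrow> nat. strict_mono q \<and> (\<forall>i. 0 < q i) \<and>
             (\<forall>x\<in>A. \<forall>j\<in>{1..d}. (\<lambda>i. (T ^^ (j * q i)) x) \<longlonglongrightarrow> g j x))) \<and>
       (\<forall>d\<ge>1. \<forall>k B. \<forall>h :: nat \<Rightarrow> 'a \<Rightarrow> 'a.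
          closedin (top_of_set (C k)) B \<longrightarrow>
          (\<forall>j\<in>{1..d}. continuous_on B (h j) \<and> h j \<in> B \<rightarrow> E) \<longrightarrow>
          (\<exists>q :: nat \<Rightarrow> nat. strict_mono q \<and> (\<forall>i. 0 < q i) \<and>
             uniform_limit (B \<times> {1..d}) (\<lambda>i (x, j). (T ^^ (j * q i)) x)
               (\<lambda>(x, j). h j x) sequentially)))"
    (is "_ \<longleftrightarrow> (\<exists>C. ?P C)")
proof
  assume "delta_weakly_mixing X T E"
  with assms(1) interpret delta_mixing X E T by unfold_locales
  obtain F r where "steered_scheme E F r T" using steered_scheme_exists by blast
  then interpret steered_scheme E F r T .
  show "\<exists>C. ?P C"
  proof (intro exI[of _ limit_set] conjI allI impI)
    fix k
    show "cantor_set (limit_set k)" "limit_set k \<subseteq> E" "limit_set k \<subseteq> limit_set (Suc k)"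
      by (rule cantor_set_limit_set limit_set_subset limit_set_Suc)+
  next
    show "E \<subseteq> closure (\<Union>k. limit_set k)" by (rule limit_sets_dense)
  next
    fix d A and g :: "nat \<Rightarrow> 'a \<Rightarrow> 'a"
    assume "A \<subseteq> (\<Union>k. limit_set k)" "\<forall>j\<in>{1..d}. continuous_on A (g j) \<and> g j \<in> A \<rightarrow> E"
    then show "\<exists>q :: nat \<Rightarrow> nat. strict_mono q \<and> (\<forall>i. 0 < q i) \<and>
        (\<forall>x\<in>A. \<forall>j\<in>{1..d}. (\<lambda>i. (T ^^ (j * q i)) x) \<longlonglongrightarrow> g j x)"
      by (intro pointwise_realization) auto
  next
    fix d k B and h :: "nat \<Rightarrow> 'a \<Rightarrow> 'a"
    assume "closedin (top_of_set (limit_set k)) B" "\<forall>j\<in>{1..d}. continuous_on B (h j) \<and> h j \<in> B \<rightarrow> E"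
    then show "\<exists>q :: nat \<Rightarrow> nat. strict_mono q \<and> (\<forall>i. 0 < q i) \<and>
        uniform_limit (B \<times> {1..d}) (\<lambda>i (x, j). (T ^^ (j * q i)) x) (\<lambda>(x, j). h j x) sequentially"
      by (intro uniform_realization) auto
  qed
next
  assume "\<exists>C. ?P C"
  then obtain C where C: "?P C" by (rule exE)
  have T: "T ^^ n \<in> X \<rightarrow> X" for n
    using assms(1) unfolding dynamical_system_def by (induction n) auto
  show "delta_weakly_mixing X T E"
  proof (rule delta_weakly_mixingI[of X E C T])
    show "cantor_set (C k) \<and> C k \<subseteq> E" for k using conjunct1[OF C] by simp
    show "E \<subseteq> closure (\<Union>k. C k)" using conjunct1[OF conjunct2[OF C]] .
    fix d A and g :: "nat \<Rightarrow> 'a \<Rightarrow> 'a"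
    assume "1 \<le> d" "A \<subseteq> (\<Union>k. C k)" "\<And>j. j \<in> {1..d} \<Longrightarrow> continuous_on A (g j) \<and> g j \<in> A \<rightarrow> E"
    then show "\<exists>q. (\<forall>i. 0 < q i) \<and> (\<forall>x\<in>A. \<forall>j\<in>{1..d}. (\<lambda>i::nat. (T ^^ (j * q i)) x) \<longlonglongrightarrow> g j x)"
      using conjunct1[OF conjunct2[OF conjunct2[OF C]], rule_format, of d A g] by blast
  qed (use assms T in auto)
qed

end
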